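(* Let $\rho\subseteq N^2$ be a binary relation and let $\sigma\subseteq(\beta N)^2$ be a continuous relation such that $\sigma\cap(N\times\beta N)=\widetilde{\rho}\cap(N\times\beta N)$. Then $\sigma\subseteq\widetilde{\rho}$.
   Context: $N=\{1,2,3,\dots\}$ is the set of natural numbers with the discrete topology, and $\beta N$ is its Stone-Čech compactification: the space of all ultrafilters on $N$, with topology generated by the base of (clopen) sets $\bar A=\{p\in\beta N: A\in p\}$, $A\subseteq N$. Each $n\in N$ is identified with the principal ultrafilter $\{A\subseteq N:n\in A\}$, so $N\subseteq\beta N$. For a relation $\sigma\subseteq X^2$ and $A\subseteq X$, $\sigma[A]=\{n\in X:\exists m\in A\ (m,n)\in\sigma\}$ and $\sigma^{-1}[A]=\{m\in X:\exists n\in A\ (m,n)\in\sigma\}$. For a topological space $X$, a relation $\sigma\subseteq X^2$ is continuous if for every open $U\subseteq X$ the set $\sigma^{-1}[U]$ is open. For $\rho\subseteq N^2$, $\widetilde{\rho}=\{(p,q)\in(\beta N)^2:\forall A\in p\ \ \rho[A]\in q\}$. *)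

theory Defs
  imports "HOL-Analysis.Analysis"
begin

definition Npos :: "nat set" where
  "Npos = {1..}"

definition ultrafilter_on :: "'a set \<Rightarrow> 'a set set \<Rightarrow> bool" where
  "ultrafilter_on X p \<longleftrightarrow>
     p \<subseteq> Pow X \<and> X \<in> p \<and> {} \<notin> p \<and>
     (\<forall>A B. A \<in> p \<longrightarrow> A \<subseteq> B \<longrightarrow> B \<subseteq> X \<longrightarrow> B \<in> p) \<and>
     (\<forall>A B. A \<in> p \<longrightarrow> B \<in> p \<longrightarrow> A \<inter> B \<in> p) \<and>
     (\<forall>A. A \<subseteq> X \<longrightarrow> A \<in> p \<or> X - A \<in> p)"

definition betaN :: "nat set set set" where
  "betaN = {p. ultrafilter_on Npos p}"

definition basic_clopen :: "nat set \<Rightarrow> nat set set set" where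
  "basic_clopen A = {p \<in> betaN. A \<in> p}"

text \<open>The family of basic sets is closed under finite intersections, so the topology
  it generates as a subbase is the one having it as a base; see
  \<open>openin_betaN_top_iff\<close> below.\<close>

definition betaN_top :: "nat set set topology" where
  "betaN_top = topology_generated_by {basic_clopen A | A. A \<subseteq> Npos}"

definition principal :: "nat \<Rightarrow> nat set set" where
  "principal n = {A. A \<subseteq> Npos \<and> n \<in> A}"

text \<open>The copy of the natural numbers inside their compactification.\<close>

definition N_in_betaN :: "nat set set set" where
  "N_in_betaN = principal ` Npos"

text \<open>In the notation of the library, the forward image of \<open>A\<close> under a relation \<open>\<sigma>\<close> is
  \<open>\<sigma> `` A\<close> and the inverse image is \<open>\<sigma>\<inverse> `` A\<close>.\<close>

definition continuous_relation :: "'a topology \<Rightarrow> ('a \<times> 'a) set \<Rightarrow> bool" where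
  "continuous_relation X \<sigma> \<longleftrightarrow>
     \<sigma> \<subseteq> topspace X \<times> topspace X \<and> (\<forall>U. openin X U \<longrightarrow> openin X (\<sigma>\<inverse> `` U))"

definition rel_ext :: "(nat \<times> nat) set \<Rightarrow> (nat set set \<times> nat set set) set" where
  "rel_ext \<rho> = {(p, q). p \<in> betaN \<and> q \<in> betaN \<and> (\<forall>A\<in>p. \<rho> `` A \<in> q)}"

lemma basic_clopen_Npos: "basic_clopen Npos = betaN"
  by (auto simp: basic_clopen_def betaN_def ultrafilter_on_def)

lemma basic_clopen_Int:
  assumes "A \<subseteq> Npos" "B \<subseteq> Npos"
  shows "basic_clopen A \<inter> basic_clopen B = basic_clopen (A \<inter> B)"
proof -
  have "A \<in> p \<and> B \<in> p \<longleftrightarrow> A \<inter> B \<in> p" if "p \<in> betaN" for p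
  proof -
    have u: "ultrafilter_on Npos p" using that by (simp add: betaN_def)
    then have up: "\<And>C. A \<inter> B \<in> p \<Longrightarrow> A \<inter> B \<subseteq> C \<Longrightarrow> C \<subseteq> Npos \<Longrightarrow> C \<in> p"
      and int: "A \<in> p \<Longrightarrow> B \<in> p \<Longrightarrow> A \<inter> B \<in> p"
      unfolding ultrafilter_on_def by blast+
    show ?thesis
      using up[OF _ Int_lower1 assms(1)] up[OF _ Int_lower2 assms(2)] int by iprover
  qed
  then show ?thesis by (auto simp: basic_clopen_def)
qed

lemma topspace_betaN_top: "topspace betaN_top = betaN"
proof
  show "topspace betaN_top \<subseteq> betaN"
    unfolding betaN_top_def topology_generated_by_topspace by (force simp: basic_clopen_def)
  have "betaN \<in> {basic_clopen A | A. A \<subseteq> Npos}" using basic_clopen_Npos by force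
  then show "betaN \<subseteq> topspace betaN_top"
    unfolding betaN_top_def topology_generated_by_topspace by (rule Union_upper)
qed

lemma openin_betaN_top_iff:
  "openin betaN_top U \<longleftrightarrow>
     U \<subseteq> betaN \<and> (\<forall>p\<in>U. \<exists>A\<subseteq>Npos. p \<in> basic_clopen A \<and> basic_clopen A \<subseteq> U)"
    (is "_ \<longleftrightarrow> ?R U")
proof
  assume "openin betaN_top U"
  then have "generate_topology_on {basic_clopen A | A. A \<subseteq> Npos} U"
    by (simp add: betaN_top_def openin_topology_generated_by)
  then show "?R U"
  proof induction
    case (Int a b)
    have "\<exists>A\<subseteq>Npos. p \<in> basic_clopen A \<and> basic_clopen A \<subseteq> a \<inter> b" if p: "p \<in> a \<inter> b" for p
    proof -
      obtain A B where "A \<subseteq> Npos" "p \<in> basic_clopen A" "basic_clopen A \<subseteq> a"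
        "B \<subseteq> Npos" "p \<in> basic_clopen B" "basic_clopen B \<subseteq> b"
        using Int.IH p by (meson IntE)
      then show ?thesis using basic_clopen_Int[of A B] by (intro exI[of _ "A \<inter> B"]) blast
    qed
    then show ?case using Int by blast
  next
    case (UN K)
    show ?case
    proof (intro conjI ballI)
      show "\<Union> K \<subseteq> betaN" using UN.IH by blast
      fix p assume "p \<in> \<Union> K"
      then obtain k where k: "k \<in> K" "p \<in> k" by blast
      then obtain A where "A \<subseteq> Npos" "p \<in> basic_clopen A" "basic_clopen A \<subseteq> k"
        using UN.IH by meson
      then show "\<exists>A\<subseteq>Npos. p \<in> basic_clopen A \<and> basic_clopen A \<subseteq> \<Union> K" using k by blast
    qed
  next
    case (Basis s)
    then show ?case by (auto simp: basic_clopen_def)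
  qed auto
next
  assume R: "?R U"
  have "openin betaN_top (basic_clopen A)" if "A \<subseteq> Npos" for A
    unfolding betaN_top_def by (rule topology_generated_by_Basis) (use that in blast)
  then show "openin betaN_top U"
    using R by (subst openin_subopen) meson
qed

lemma principal_in_betaN:
  assumes "n \<in> Npos"
  shows "principal n \<in> betaN"
  using assms by (auto simp: principal_def betaN_def ultrafilter_on_def)

end

theory Submission
  imports Defs
begin

text \<open>Suppose \<open>(p, q) \<in> \<sigma>\<close> but \<open>\<rho> `` A \<notin> q\<close> for some \<open>A \<in> p\<close>. Then the complement \<open>B\<close> of
  \<open>\<rho> `` A\<close> lies in \<open>q\<close>, so \<open>p\<close> belongs to the preimage under \<open>\<sigma>\<close> of the clopen set of
  ultrafilters containing \<open>B\<close>. By continuity that preimage is open, and since the principal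
  ultrafilters at points of \<open>A\<close> accumulate at \<open>p\<close> (\<open>principal_in_open\<close>), it contains one of them,
  at \<open>n\<close> say. Hence \<open>n\<close> is \<open>\<sigma>\<close>-related to an ultrafilter \<open>r\<close> with \<open>B \<in> r\<close>. But
  over \<open>n\<close> the relation \<open>\<sigma>\<close> is the extension of \<open>\<rho>\<close>, which forces \<open>\<rho> `` A \<in> r\<close>,
  and disjoint sets cannot both lie in an ultrafilter.\<close>

lemma betaN_subset: "p \<in> betaN \<Longrightarrow> A \<in> p \<Longrightarrow> A \<subseteq> Npos"
  by (auto simp: betaN_def ultrafilter_on_def)

lemma betaN_Int_nonempty: "p \<in> betaN \<Longrightarrow> A \<in> p \<Longrightarrow> B \<in> p \<Longrightarrow> A \<inter> B \<noteq> {}"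
  unfolding betaN_def ultrafilter_on_def by fastforce

lemma betaN_Diff: "p \<in> betaN \<Longrightarrow> A \<subseteq> Npos \<Longrightarrow> A \<notin> p \<Longrightarrow> Npos - A \<in> p"
  unfolding betaN_def ultrafilter_on_def by blast

lemma openin_basic_clopen: "A \<subseteq> Npos \<Longrightarrow> openin betaN_top (basic_clopen A)"
  by (auto simp: openin_betaN_top_iff basic_clopen_def)

text \<open>A localized form of the density of the natural numbers in their compactification:
  every set in \<open>p\<close>, viewed as a set of points, has \<open>p\<close> in its closure. A basic neighbourhood of
  \<open>p\<close> is given by some \<open>C \<in> p\<close>, and any element of \<open>A \<inter> C\<close> serves.\<close>

lemma principal_in_open:
  assumes "openin betaN_top U" "p \<in> U" "A \<in> p"
  obtains n where "n \<in> A" "principal n \<in> U"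
proof -
  obtain C where C: "p \<in> basic_clopen C" "basic_clopen C \<subseteq> U"
    using assms(1,2) unfolding openin_betaN_top_iff by blast
  then have p: "p \<in> betaN" "C \<in> p" by (simp_all add: basic_clopen_def)
  then obtain n where n: "n \<in> A" "n \<in> C"
    using betaN_Int_nonempty assms(3) by blast
  have "C \<subseteq> Npos" using betaN_subset p by blast
  then have "principal n \<in> basic_clopen C"
    using n principal_in_betaN by (auto simp: basic_clopen_def principal_def)
  with C n show thesis using that by blast
qed

theorem theorem2p10:
  fixes \<rho> :: "(nat \<times> nat) set" and \<sigma> :: "(nat set set \<times> nat set set) set"
  assumes "\<rho> \<subseteq> Npos \<times> Npos"
    and "\<sigma> \<subseteq> betaN \<times> betaN"
    and "continuous_relation betaN_top \<sigma>"
    and "\<sigma> \<inter> (N_in_betaN \<times> betaN) = rel_ext \<rho> \<inter> (N_in_betaN \<times> betaN)"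
  shows "\<sigma> \<subseteq> rel_ext \<rho>"
proof (rule subrelI)
  fix p q assume pq: "(p, q) \<in> \<sigma>"
  then have p: "p \<in> betaN" and q: "q \<in> betaN" using assms(2) by auto
  have "\<rho> `` A \<in> q" if A: "A \<in> p" for A
  proof (rule ccontr)
    assume "\<rho> `` A \<notin> q"
    define B where "B = Npos - \<rho> `` A"
    have "\<rho> `` A \<subseteq> Npos" using assms(1) by blast
    then have "B \<in> q" unfolding B_def using \<open>\<rho> `` A \<notin> q\<close> by (rule betaN_Diff[OF q])
    then have "p \<in> \<sigma>\<inverse> `` basic_clopen B" using pq q by (auto simp: basic_clopen_def)
    moreover have "openin betaN_top (\<sigma>\<inverse> `` basic_clopen B)"
      using assms(3) openin_basic_clopen[of B] by (auto simp: continuous_relation_def B_def)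
    ultimately obtain n where n: "n \<in> A" "principal n \<in> \<sigma>\<inverse> `` basic_clopen B"
      using principal_in_open A by metis
    then obtain r where r: "(principal n, r) \<in> \<sigma>" "r \<in> betaN" "B \<in> r"
      by (auto simp: basic_clopen_def)
    have "A \<subseteq> Npos" using betaN_subset p A by blast
    then have "principal n \<in> N_in_betaN" "A \<in> principal n"
      using n(1) by (auto simp: N_in_betaN_def principal_def)
    then have "\<rho> `` A \<in> r" using r assms(4) by (auto simp: rel_ext_def)
    then show False using betaN_Int_nonempty[OF r(2) _ r(3)] by (auto simp: B_def)
  qed
  then show "(p, q) \<in> rel_ext \<rho>" using p q by (simp add: rel_ext_def)
qed

end
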